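(* Let $G$ be a mop of order $n \geq 4$ with exactly $n_2$ vertices of degree $2$. Then \[\gamma(G) \leq \frac{n-n_2+\mathbf{1}(n,n_2)}{2}.\] Moreover, equality holds if $G$ is extreme or $n=4$.
   Context: All graphs are finite and simple. The order of $G$ is $|V(G)|$. A triangulated disc is a plane graph whose interior faces are triangles and whose exterior (unbounded) face is bounded by a simple cycle. A maximal outerplanar graph, or mop, is a triangulated disc $G$ such that the boundary of the exterior face of $G$ contains all the vertices of $G$. Every mop has a unique Hamiltonian cycle, namely the boundary of its exterior face. $\gamma(G)$ is the domination number of $G$: the minimum size of a set $S\subseteq V(G)$ such that every vertex of $V(G)\setminus S$ is adjacent to a vertex of $S$. $N_G(v)$ denotes the set of neighbors of $v$ in $G$. For positive integers $a,b$, $\mathbf{1}(a,b)=1$ if $b$ is odd and $a=2b$, and $\mathbf{1}(a,b)=0$ otherwise. Extreme mops: a mop $G$ is called $t$-extreme (or simply extreme), where $t\ge 3$, if $G$ contains a mop $M$ with unique Hamiltonian cycle $C = x_1x_2\dots x_tx_1$ and distinct vertices $y_1,\dots,y_t$ of $G$ lying in the exterior face of $M$ such that $N_G(y_i)=\{x_i,x_{i+1}\}$ for each $i\in\{1,\dots,t-1\}$, $N_G(y_t)=\{x_t,x_1\}$, $V(G)=V(M)\cup\{y_1,\dots,y_t\}$, and $E(G)=E(M)\cup\bigcup_{i=1}^{t}\{y_ix : x\in N_G(y_i)\}$. *)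

theory Defs
  imports "HOL-Analysis.Analysis"
begin

text \<open>The plane is the type of complex numbers, and an edge of a plane graph is the point set
  of an arc (a homeomorphic image of the unit interval), including its two end vertices.\<close>

record pgraph =
  verts :: "complex set"
  edges :: "complex set set"

definition order :: "pgraph \<Rightarrow> nat" where
  "order G = card (verts G)"

text \<open>In a plane graph the vertices lying on an edge are exactly its two ends.\<close>

definition ends :: "pgraph \<Rightarrow> complex set \<Rightarrow> complex set" where
  "ends G e = e \<inter> verts G"

text \<open>Finite simple plane graphs. There are no loops because the ends of an arc are distinct;
  the conjunct \<open>ends G e \<noteq> ends G f\<close> excludes parallel edges. The interior of
  an edge contains no vertex and no point of another edge.\<close>

definition plane_graph :: "pgraph \<Rightarrow> bool" where
  "plane_graph G \<longleftrightarrow>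
     finite (verts G) \<and> finite (edges G) \<and>
     (\<forall>e\<in>edges G. \<exists>g. arc g \<and> path_image g = e \<and> ends G e = {pathstart g, pathfinish g}) \<and>
     (\<forall>e\<in>edges G. \<forall>f\<in>edges G. e \<noteq> f \<longrightarrow> ends G e \<noteq> ends G f \<and> e \<inter> f \<subseteq> verts G)"

definition subgraph :: "pgraph \<Rightarrow> pgraph \<Rightarrow> bool" where
  "subgraph H G \<longleftrightarrow> verts H \<subseteq> verts G \<and> edges H \<subseteq> edges G"

definition nbhd :: "pgraph \<Rightarrow> complex \<Rightarrow> complex set" where
  "nbhd G v = {u. \<exists>e\<in>edges G. ends G e = {u, v}}"

definition degree :: "pgraph \<Rightarrow> complex \<Rightarrow> nat" where
  "degree G v = card (nbhd G v)"

definition dominating :: "pgraph \<Rightarrow> complex set \<Rightarrow> bool" where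
  "dominating G S \<longleftrightarrow> S \<subseteq> verts G \<and> (\<forall>v\<in>verts G - S. nbhd G v \<inter> S \<noteq> {})"

definition domination_number :: "pgraph \<Rightarrow> nat" where
  "domination_number G = Min (card ` {S. dominating G S})"

text \<open>A cycle is given by the list of its vertices in cyclic order.\<close>

definition cycle :: "pgraph \<Rightarrow> complex list \<Rightarrow> bool" where
  "cycle G xs \<longleftrightarrow> 3 \<le> length xs \<and> distinct xs \<and> set xs \<subseteq> verts G \<and>
     (\<forall>i<length xs. xs ! (Suc i mod length xs) \<in> nbhd G (xs ! i))"

definition hamiltonian_cycle :: "pgraph \<Rightarrow> complex list \<Rightarrow> bool" where
  "hamiltonian_cycle G xs \<longleftrightarrow> cycle G xs \<and> set xs = verts G"

definition cycle_edges :: "pgraph \<Rightarrow> complex list \<Rightarrow> complex set set" where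
  "cycle_edges G xs =
     {e \<in> edges G. \<exists>i<length xs. ends G e = {xs ! i, xs ! (Suc i mod length xs)}}"

definition points :: "pgraph \<Rightarrow> complex set" where
  "points G = verts G \<union> \<Union> (edges G)"

definition faces :: "pgraph \<Rightarrow> complex set set" where
  "faces G = components (- points G)"

definition interior_face :: "pgraph \<Rightarrow> complex set \<Rightarrow> bool" where
  "interior_face G F \<longleftrightarrow> F \<in> faces G \<and> bounded F"

definition exterior_face :: "pgraph \<Rightarrow> complex set" where
  "exterior_face G = outside (points G)"

definition bounded_by_cycle :: "pgraph \<Rightarrow> complex set \<Rightarrow> complex list \<Rightarrow> bool" where
  "bounded_by_cycle G F xs \<longleftrightarrow> cycle G xs \<and> frontier F = \<Union> (cycle_edges G xs)"

definition triangulated_disc :: "pgraph \<Rightarrow> bool" where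
  "triangulated_disc G \<longleftrightarrow> plane_graph G \<and>
     (\<forall>F. interior_face G F \<longrightarrow> (\<exists>xs. length xs = 3 \<and> bounded_by_cycle G F xs)) \<and>
     (\<exists>xs. bounded_by_cycle G (exterior_face G) xs)"

definition mop :: "pgraph \<Rightarrow> bool" where
  "mop G \<longleftrightarrow> triangulated_disc G \<and> verts G \<subseteq> frontier (exterior_face G)"

text \<open>Indices run from \<open>0\<close> to \<open>t - 1\<close>. The last conjunct says that the edges of \<open>G\<close> not in \<open>M\<close>
  are those joining some \<open>y\<^sub>i\<close> to one of its neighbours.\<close>

definition t_extreme :: "nat \<Rightarrow> pgraph \<Rightarrow> bool" where
  "t_extreme t G \<longleftrightarrow> 3 \<le> t \<and> mop G \<and>
     (\<exists>M xs ys. subgraph M G \<and> mop M \<and> hamiltonian_cycle M xs \<and> length xs = t \<and>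
        length ys = t \<and> distinct ys \<and> set ys \<subseteq> verts G \<inter> exterior_face M \<and>
        (\<forall>i<t. nbhd G (ys ! i) = {xs ! i, xs ! (Suc i mod t)}) \<and>
        verts G = verts M \<union> set ys \<and>
        edges G = edges M \<union>
          (\<Union>i<t. {e \<in> edges G. \<exists>x\<in>nbhd G (ys ! i). ends G e = {ys ! i, x}}))"

definition extreme :: "pgraph \<Rightarrow> bool" where
  "extreme G \<longleftrightarrow> (\<exists>t\<ge>3. t_extreme t G)"

definition ind :: "nat \<Rightarrow> nat \<Rightarrow> nat" where
  "ind a b = (if odd b \<and> a = 2 * b then 1 else 0)"

text \<open>\<open>outside\<close> collects all unbounded components; for a plane graph there is
  exactly one of them.\<close>

lemma compact_points:
  assumes "plane_graph G"
  shows "compact (points G)"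
proof -
  have "compact e" if e: "e \<in> edges G" for e
  proof -
    have "\<exists>g. arc g \<and> path_image g = e \<and> ends G e = {pathstart g, pathfinish g}"
      using assms e unfolding plane_graph_def by (elim conjE bspec)
    then obtain g where g: "arc g" "path_image g = e"
      by (elim exE conjE)
    then show ?thesis using compact_path_image[OF arc_imp_path[OF g(1)]] g(2) by simp
  qed
  moreover have "finite (verts G)" "finite (edges G)"
    using assms unfolding plane_graph_def by simp_all
  ultimately show ?thesis
    unfolding points_def by (simp add: compact_Un compact_Union finite_imp_compact)
qed

lemma exterior_face_in_faces:
  assumes "plane_graph G"
  shows "exterior_face G \<in> faces G" and "\<not> bounded (exterior_face G)"
    and "F \<in> faces G \<Longrightarrow> \<not> bounded F \<Longrightarrow> F = exterior_face G"
proof -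
  have bdd: "bounded (points G)"
    using compact_points[OF assms] compact_imp_bounded by blast
  show unb: "\<not> bounded (exterior_face G)"
    unfolding exterior_face_def using bdd unbounded_outside by blast
  then have ne: "exterior_face G \<noteq> {}" by auto
  have con: "connected (exterior_face G)"
    unfolding exterior_face_def using bdd by (intro connected_outside) auto
  have sub: "exterior_face G \<subseteq> - points G"
    unfolding exterior_face_def using outside_no_overlap by blast
  have "- points G \<noteq> {}" using ne sub by blast
  then obtain C where C: "C \<in> components (- points G)" "exterior_face G \<subseteq> C"
    using exists_component_superset[OF sub _ con] by blast
  have unbC: "\<not> bounded C" using C(2) unb bounded_subset by blast
  have uniq: "F = C" if "F \<in> components (- points G)" "\<not> bounded F" for F
    by (rule cobounded_unique_unbounded_components[of "- points G" C F])
      (use that C(1) unbC bdd in simp_all)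
  obtain z where z: "C = connected_component_set (- points G) z"
    using C(1) by (rule componentsE)
  have "C \<subseteq> exterior_face G"
  proof
    fix x assume x: "x \<in> C"
    have "x \<notin> points G" using x in_components_subset[OF C(1)] by blast
    moreover have "connected_component_set (- points G) x = C"
      using x connected_component_eq unfolding z by blast
    ultimately show "x \<in> exterior_face G"
      unfolding exterior_face_def outside_def using unbC by simp
  qed
  then have eq: "exterior_face G = C" using C(2) by blast
  show "exterior_face G \<in> faces G"
    unfolding eq faces_def by (rule C(1))
  show "F = exterior_face G" if "F \<in> faces G" "\<not> bounded F"
    unfolding eq using that unfolding faces_def by (rule uniq)
qed

end

theory Submission
  imports Defs
begin

text \<open>
  Let \<open>Z\<close> be the set of vertices whose degree is not two. The idea of the upper bound is to take
  every second vertex of \<open>Z\<close> in the cyclic order given by the Hamiltonian cycle. This works because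
  of one geometric fact: the two neighbours of a vertex of degree two are adjacent
  (\<open>degree_two_neighbours_adjacent\<close>). Hence skipping all vertices of degree two leaves
  consecutive members of \<open>Z\<close> adjacent, and each skipped vertex is adjacent to two consecutive
  members of \<open>Z\<close>. A subset of \<open>Z\<close> hitting every pair of consecutive members thus dominates
  everything (\<open>dominating_half\<close>). For \<open>n \<ge> 4\<close> no two vertices of degree two are adjacent, so
  \<open>n2 \<le> card Z\<close>. If \<open>n2 < card Z\<close>, some two members of \<open>Z\<close> follow each other directly on the
  Hamiltonian cycle; the cycle can be cut between them, since no skipped vertex depends on this pair,
  and on the resulting path \<open>card Z div 2\<close> vertices suffice. If \<open>n2 = card Z\<close>, then \<open>n = 2 * n2\<close>, and
  going once around the whole cycle costs half a vertex more when \<open>card Z\<close> is odd. This is the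
  indicator term.

  The geometric fact follows from the Jordan curve theorem. The exterior boundary passes through all
  vertices, so it is a Hamiltonian cycle, and every vertex is on the boundary of the inside of the
  corresponding Jordan curve. Therefore every vertex is a corner of some interior face, which is
  a triangle (\<open>triangle_at_cycle_vertex\<close>). For a vertex of degree two the other corners are its two
  neighbours.

  For an extreme graph \<open>n = 2 * t\<close> and \<open>n2 = t\<close>, and a single vertex dominates at most two of the
  \<open>t\<close> vertices of degree two; hence \<open>t \<le> 2 * domination_number G\<close>, and parity gives equality. For
  \<open>n = 4\<close> equality amounts to the presence of two vertices of degree two, that is, to \<open>G\<close> not being
  complete. In a complete graph both chords of the exterior 4-cycle would lie inside it and
  have to cross (\<open>exterior_four_cycle_not_both_chords\<close>).
\<close>

section \<open>Arcs have no interior points\<close>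

text \<open>An open subset of the plane inside an arc would be mapped injectively and continuously into
  the real line by the inverse of the arc, contradicting invariance of dimension.\<close>

lemma interior_arc_empty:
  fixes g :: "real \<Rightarrow> complex"
  assumes "arc g"
  shows "interior (path_image g) = {}"
proof (rule ccontr)
  assume ne: "interior (path_image g) \<noteq> {}"
  have cont: "continuous_on {0..1} g" and inj: "inj_on g {0..1}"
    using assms by (auto simp: arc_def path_def)
  have "continuous_on (g ` {0..1}) (inv_into {0..1} g)"
    by (intro continuous_on_inv cont compact_Icc) (simp add: inj)
  then have "continuous_on (interior (path_image g)) (inv_into {0..1} g)"
    by (rule continuous_on_subset) (use interior_subset[of "path_image g"] in \<open>simp add: path_image_def\<close>)
  moreover have "inj_on (inv_into {0..1} g) (interior (path_image g))"
    by (rule inj_on_subset[OF inj_on_inv_into[of "path_image g"]])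
       (use interior_subset[of "path_image g"] in \<open>simp_all add: path_image_def\<close>)
  ultimately have "DIM(complex) \<le> DIM(real)"
    by (intro invariance_of_dimension[OF _ open_interior _ ne])
  then show False by simp
qed

lemma interior_Union_empty:
  assumes "finite \<A>" and "\<And>A. A \<in> \<A> \<Longrightarrow> closed A \<and> interior A = {}"
  shows "interior (\<Union>\<A>) = {}"
  using assms
  by (induction rule: finite_induct) (auto simp: interior_closed_Un_empty_interior)

section \<open>Plane graphs, walks and the curves they trace\<close>

lemma edgeE:
  assumes "plane_graph G" and "e \<in> edges G"
  obtains g where "arc g" "path_image g = e" "ends G e = {pathstart g, pathfinish g}"
proof -
  have "\<forall>e\<in>edges G. \<exists>g. arc g \<and> path_image g = e \<and> ends G e = {pathstart g, pathfinish g}"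
    using assms(1) unfolding plane_graph_def by (elim conjE)
  then show thesis using assms(2) that by (elim ballE exE) auto
qed

lemma edges_meet_in_common_ends:
  assumes "plane_graph G" "e \<in> edges G" "f \<in> edges G" "e \<noteq> f"
  shows "e \<inter> f \<subseteq> ends G e \<inter> ends G f"
proof -
  have "\<forall>e\<in>edges G. \<forall>f\<in>edges G. e \<noteq> f \<longrightarrow> ends G e \<noteq> ends G f \<and> e \<inter> f \<subseteq> verts G"
    using assms(1) unfolding plane_graph_def by (elim conjE)
  then show ?thesis using assms by (fastforce simp: ends_def)
qed

lemma edge_eqI:
  assumes "plane_graph G" "e \<in> edges G" "f \<in> edges G" "ends G e = ends G f"
  shows "e = f"
proof -
  have "\<forall>e\<in>edges G. \<forall>f\<in>edges G. e \<noteq> f \<longrightarrow> ends G e \<noteq> ends G f \<and> e \<inter> f \<subseteq> verts G"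
    using assms(1) unfolding plane_graph_def by (elim conjE)
  then show ?thesis using assms by blast
qed

lemma card_ends:
  assumes "plane_graph G" "e \<in> edges G"
  shows "card (ends G e) = 2"
  by (rule edgeE[OF assms]) (auto dest: arc_distinct_ends)

lemma nbhd_sym: "u \<in> nbhd G v \<longleftrightarrow> v \<in> nbhd G u"
  by (auto simp: nbhd_def insert_commute)

lemma nbhd_subset_verts: "nbhd G v \<subseteq> verts G"
  by (auto simp: nbhd_def ends_def)

lemma nbhd_irrefl:
  assumes "plane_graph G" shows "v \<notin> nbhd G v"
  using card_ends[OF assms] by (fastforce simp: nbhd_def)

lemma edge_arc_between:
  assumes G: "plane_graph G" and "u \<in> nbhd G v"
  obtains g where "arc g" "pathstart g = v" "pathfinish g = u"
    "{e \<in> edges G. ends G e = {v, u}} = {path_image g}"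
proof -
  obtain e where e: "e \<in> edges G" "ends G e = {v, u}"
    using assms(2) by (auto simp: nbhd_def insert_commute)
  obtain g where g: "arc g" "path_image g = e" "ends G e = {pathstart g, pathfinish g}"
    using edgeE[OF G e(1)] .
  have unique: "{f \<in> edges G. ends G f = {v, u}} = {e}"
  proof -
    have "f = e" if "f \<in> edges G" "ends G f = {v, u}" for f
      using edge_eqI[OF G that(1) e(1)] that(2) e(2) by simp
    then show ?thesis using e by blast
  qed
  have "pathstart g = v \<and> pathfinish g = u \<or> pathstart g = u \<and> pathfinish g = v"
    using g(3) e(2) by (auto simp: doubleton_eq_iff)
  then show thesis
  proof
    assume "pathstart g = v \<and> pathfinish g = u"
    then show thesis using that[of g] g unique by simp
  next
    assume "pathstart g = u \<and> pathfinish g = v"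
    then show thesis using that[of "reversepath g"] g unique by (simp add: arc_reversepath)
  qed
qed

abbreviation walk :: "pgraph \<Rightarrow> complex list \<Rightarrow> bool" where
  "walk G \<equiv> successively (\<lambda>u v. v \<in> nbhd G u)"

text \<open>Each step of the walk contributes the set of all edges joining its two vertices. In a plane
  graph this is a single edge, but the recursion does not have to choose one.\<close>

fun walk_edges :: "pgraph \<Rightarrow> complex list \<Rightarrow> complex set set" where
  "walk_edges G (u # v # xs) = {e \<in> edges G. ends G e = {u, v}} \<union> walk_edges G (v # xs)"
| "walk_edges G _ = {}"

lemma walk_edges_subset: "walk_edges G xs \<subseteq> edges G"
  by (induction G xs rule: walk_edges.induct) auto

lemma ends_walk_edges: "e \<in> walk_edges G xs \<Longrightarrow> ends G e \<subseteq> set xs"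
  by (induction G xs rule: walk_edges.induct) auto

lemma set_subset_walk_edges:
  assumes "walk G xs" "2 \<le> length xs"
  shows "set xs \<subseteq> \<Union> (walk_edges G xs)"
  using assms
proof (induction G xs rule: walk_edges.induct)
  case (1 G u v xs)
  obtain e where "e \<in> edges G" "ends G e = {u, v}"
    using "1.prems" by (auto simp: nbhd_def insert_commute)
  then have "{u, v} \<subseteq> \<Union> (walk_edges G (u # v # xs))"
    by (auto simp: ends_def)
  moreover have "set (v # xs) \<subseteq> \<Union> (walk_edges G (u # v # xs))" if "xs \<noteq> []"
    using "1.IH" "1.prems" that by (cases xs) auto
  ultimately show ?case by (cases "xs = []") auto
qed auto

text \<open>Distinct edges meet only in common ends. This is what makes the curves traced by two walks
  without a common edge as disjoint as their vertex sets.\<close>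

lemma walks_meet:
  assumes "plane_graph G" "walk_edges G xs \<inter> walk_edges G ys = {}"
  shows "\<Union> (walk_edges G xs) \<inter> \<Union> (walk_edges G ys) \<subseteq> set xs \<inter> set ys"
proof
  fix z assume "z \<in> \<Union> (walk_edges G xs) \<inter> \<Union> (walk_edges G ys)"
  then obtain e f where ef: "e \<in> walk_edges G xs" "f \<in> walk_edges G ys" "z \<in> e \<inter> f"
    by blast
  then have "e \<noteq> f" using assms(2) by blast
  then have "z \<in> ends G e \<inter> ends G f"
    using edges_meet_in_common_ends[OF assms(1)] ef walk_edges_subset by blast
  then show "z \<in> set xs \<inter> set ys" using ends_walk_edges ef by blast
qed

text \<open>Each new edge starts at a vertex that does not occur later, so by the previous lemma it meets
  the arc traced by the remaining walk in their common end only.\<close>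

lemma arc_along_walk:
  assumes "plane_graph G" "walk G xs" "distinct xs" "2 \<le> length xs"
  obtains g where "arc g" "pathstart g = hd xs" "pathfinish g = last xs"
    "path_image g = \<Union> (walk_edges G xs)"
proof -
  have "\<exists>g. arc g \<and> pathstart g = hd xs \<and> pathfinish g = last xs \<and>
    path_image g = \<Union> (walk_edges G xs)"
    using assms
  proof (induction xs rule: induct_list012)
    case (3 u v xs)
    obtain g where g: "arc g" "pathstart g = u" "pathfinish g = v"
      "{e \<in> edges G. ends G e = {u, v}} = {path_image g}"
      using edge_arc_between[OF \<open>plane_graph G\<close>, of v u] "3.prems" by auto
    show ?case
    proof (cases "xs = []")
      case True
      then show ?thesis using g by auto
    next
      case False
      then obtain h where h: "arc h" "pathstart h = v" "pathfinish h = last xs"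
        "path_image h = \<Union> (walk_edges G (v # xs))"
        using "3.IH"(2) "3.prems" by (cases xs) auto
      have "walk_edges G [u, v] \<inter> walk_edges G (v # xs) = {}"
        using ends_walk_edges[of _ G "v # xs"] "3.prems" by auto
      from walks_meet[OF \<open>plane_graph G\<close> this]
      have "path_image g \<inter> path_image h \<subseteq> {v}"
        using g(4) h(4) "3.prems" by auto
      then have "arc (g +++ h)"
        using g h by (intro arc_join) auto
      moreover have "path_image (g +++ h) = \<Union> (walk_edges G (u # v # xs))"
        using g h by (simp add: path_image_join)
      ultimately show ?thesis using g h False by auto
    qed
  qed auto
  then show thesis using that by blast
qed

lemma cycle_walk:
  assumes "cycle G xs"
  shows "walk G (xs @ [hd xs])"
proof -
  have "(xs @ [hd xs]) ! Suc i \<in> nbhd G ((xs @ [hd xs]) ! i)" if "i < length xs" for i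
  proof -
    have "(xs @ [hd xs]) ! Suc i = xs ! (Suc i mod length xs)"
      using that hd_conv_nth[of xs] by (cases "xs = []"; cases "Suc i = length xs") (auto simp: nth_append)
    moreover have "(xs @ [hd xs]) ! i = xs ! i" using that by (simp add: nth_append)
    ultimately show ?thesis using assms that by (simp add: cycle_def)
  qed
  then show ?thesis by (simp add: successively_conv_nth)
qed

lemma cycle_rotate:
  assumes "cycle G xs"
  shows "cycle G (rotate k xs)"
proof -
  have "rotate k xs ! (Suc i mod length xs) \<in> nbhd G (rotate k xs ! i)" if "i < length xs" for i
  proof -
    have "0 < length xs" using that by linarith
    have "Suc i mod length xs < length xs" "(k + i) mod length xs < length xs"
      using \<open>0 < length xs\<close> by simp_all
    moreover have "(k + Suc i mod length xs) mod length xs = Suc ((k + i) mod length xs) mod length xs"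
      by (simp add: mod_simps)
    ultimately show ?thesis
      using assms that by (simp add: cycle_def nth_rotate)
  qed
  then show ?thesis using assms by (simp add: cycle_def)
qed

text \<open>The cycle is cut at the two neighbours of one of its vertices, \<open>x\<close>: every edge of one part
  contains \<open>x\<close> and no edge of the other does, so that both parts are arcs sharing their ends only.\<close>

lemma closed_curve_along_cycle:
  assumes G: "plane_graph G" and "cycle G xs"
  obtains c where "simple_path c" "pathfinish c = pathstart c" "set xs \<subseteq> path_image c"
    "path_image c \<subseteq> points G"
proof -
  obtain x ys where xs: "xs = x # ys" and ys: "2 \<le> length ys"
    using assms(2) unfolding cycle_def by (cases xs) auto
  define zs where "zs = [last ys, x, hd ys]"
  have dist: "distinct (x # ys)" using assms(2) xs by (simp add: cycle_def)
  have w: "walk G (x # ys)" "x \<in> nbhd G (last ys)" 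
    using cycle_walk[OF assms(2)] ys unfolding xs by (auto simp: successively_append_iff successively_Cons hd_append split: if_splits)
  have wy: "walk G ys" "walk G zs" using w ys by (auto simp: zs_def successively_Cons)
  have ne: "hd ys \<noteq> last ys"
    using dist ys by (cases ys) auto
  have dz: "distinct zs" using dist ys ne by (auto simp: zs_def) (metis last_in_set hd_in_set list.size(3) not_numeral_le_zero)+
  obtain g where g: "arc g" "pathstart g = hd ys" "pathfinish g = last ys"
    "path_image g = \<Union> (walk_edges G ys)"
    using arc_along_walk[OF G wy(1)] dist ys by auto
  obtain h where h: "arc h" "pathstart h = last ys" "pathfinish h = hd ys"
    "path_image h = \<Union> (walk_edges G zs)"
    using arc_along_walk[OF G wy(2) dz] by (auto simp: zs_def)
  have "walk_edges G ys \<inter> walk_edges G zs = {}"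
    using ends_walk_edges[of _ G ys] dist by (auto simp: zs_def)
  moreover have "set ys \<inter> set zs \<subseteq> {hd ys, last ys}"
    using dist by (auto simp: zs_def)
  ultimately have "path_image g \<inter> path_image h \<subseteq> {hd ys, last ys}"
    using walks_meet[OF G] unfolding g(4) h(4) by (meson order_trans)
  then have "simple_path (g +++ h)"
    using g h by (intro simple_path_join_loop) auto
  moreover have "pathfinish (g +++ h) = pathstart (g +++ h)" using g h by simp
  moreover have im: "path_image (g +++ h) = \<Union> (walk_edges G ys) \<union> \<Union> (walk_edges G zs)"
    using g h by (simp add: path_image_join)
  moreover have "set xs \<subseteq> path_image (g +++ h)"
    using set_subset_walk_edges[OF wy(1) ys] set_subset_walk_edges[OF wy(2)]
    unfolding im xs by (auto simp: zs_def)
  moreover have "path_image (g +++ h) \<subseteq> points G"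
    unfolding im points_def using walk_edges_subset by blast
  ultimately show thesis using that by blast
qed

section \<open>The two neighbours of a vertex of degree two\<close>

lemma interior_points_empty:
  assumes "plane_graph G" shows "interior (points G) = {}"
proof -
  have "interior (\<Union> (edges G)) = {}"
  proof (rule interior_Union_empty)
    show "finite (edges G)" using assms by (simp add: plane_graph_def)
    show "closed e \<and> interior e = {}" if "e \<in> edges G" for e
      using edgeE[OF assms that] interior_arc_empty closed_arc_image by metis
  qed
  moreover have "finite (verts G)" using assms by (simp add: plane_graph_def)
  ultimately show ?thesis
    unfolding points_def
    by (simp add: interior_closed_Un_empty_interior finite_imp_closed empty_interior_finite)
qed

lemma cycle_edges_ends:
  assumes "f \<in> cycle_edges G ts" "v \<in> f" "v \<in> verts G"
  shows "v \<in> set ts"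
proof -
  obtain i where i: "i < length ts" "ends G f = {ts ! i, ts ! (Suc i mod length ts)}"
    using assms by (auto simp: cycle_edges_def)
  have "v \<in> ends G f" using assms by (auto simp: ends_def)
  moreover have "Suc i mod length ts < length ts" using i by (intro mod_less_divisor) auto
  ultimately show ?thesis using i by auto
qed

text \<open>Close to a vertex \<open>v\<close> of a cycle lie points inside the Jordan curve of that cycle, and some of
  them lie off the graph because the graph has no interior points. Such a point belongs to a bounded
  face, which is therefore a triangle. A small ball around \<open>v\<close> meets the boundary of
  that face, and meets no edge except those ending in \<open>v\<close>; so \<open>v\<close> is a corner of the triangle.\<close>

lemma triangle_at_cycle_vertex:
  assumes G: "plane_graph G" and xs: "cycle G xs" "v \<in> set xs"
    and tri: "\<And>F. interior_face G F \<Longrightarrow> \<exists>ts. length ts = 3 \<and> bounded_by_cycle G F ts"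
  obtains ts where "length ts = 3" "cycle G ts" "v \<in> set ts"
proof -
  have v: "v \<in> verts G" using xs by (auto simp: cycle_def)
  obtain c where c: "simple_path c" "pathfinish c = pathstart c" "set xs \<subseteq> path_image c"
    "path_image c \<subseteq> points G"
    using closed_curve_along_cycle[OF G xs(1)] .
  have J: "open (inside (path_image c))" "frontier (inside (path_image c)) = path_image c"
    using Jordan_inside_outside[OF c(1,2)] by blast+
  \<comment> \<open>The ball has to avoid all edges that do not contain \<open>v\<close>.\<close>
  define K where "K = \<Union> {e \<in> edges G. v \<notin> e}"
  have "closed e" if "e \<in> edges G" for e
    using edgeE[OF G that] closed_arc_image by metis
  then have "closed K"
    unfolding K_def using G by (intro closed_Union) (auto simp: plane_graph_def)
  moreover have "v \<notin> K" by (auto simp: K_def)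
  ultimately obtain \<epsilon> where \<epsilon>: "\<epsilon> > 0" "ball v \<epsilon> \<subseteq> - K"
    using open_contains_ball[of "- K"] by (auto simp: open_Compl)
  \<comment> \<open>A point \<open>p\<close> near \<open>v\<close>, inside the curve and off the graph: its face is bounded.\<close>
  have "v \<in> closure (inside (path_image c))"
    using J(2) c(3) xs(2) unfolding frontier_def by blast
  then have "ball v \<epsilon> \<inter> inside (path_image c) \<noteq> {}"
    using \<epsilon>(1) open_Int_closure_eq_empty[OF open_ball] centre_in_ball by blast
  moreover have "open (ball v \<epsilon> \<inter> inside (path_image c))"
    using J(1) by (intro open_Int open_ball)
  ultimately obtain p where p: "p \<in> ball v \<epsilon>" "p \<in> inside (path_image c)" "p \<notin> points G"
    using interior_maximal[of "ball v \<epsilon> \<inter> inside (path_image c)" "points G"]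
      interior_points_empty[OF G] by blast
  define F where "F = connected_component_set (- points G) p"
  have "F \<in> faces G"
    using p(3) by (auto simp: F_def faces_def components_def)
  moreover have "F \<subseteq> connected_component_set (- path_image c) p"
    unfolding F_def using c(4) by (intro connected_component_mono) auto
  then have "bounded F"
    using p(2) bounded_subset by (auto simp: inside_def)
  ultimately obtain ts where ts: "length ts = 3" "cycle G ts" "frontier F = \<Union> (cycle_edges G ts)"
    using tri unfolding interior_face_def bounded_by_cycle_def by blast
  have "v \<notin> F"
    using v connected_component_subset unfolding F_def points_def by blast
  moreover have "v \<in> ball v \<epsilon>" using \<epsilon>(1) by simp
  moreover have "p \<in> F" using p(3) by (simp add: F_def)
  ultimately have "ball v \<epsilon> \<inter> frontier F \<noteq> {}"
    using p(1) by (intro connected_Int_frontier connected_ball) blast+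
  then obtain q f where f: "q \<in> ball v \<epsilon>" "q \<in> f" "f \<in> cycle_edges G ts"
    using ts(3) by blast
  then have "v \<in> f"
    using \<epsilon>(2) by (auto simp: K_def cycle_edges_def)
  then have "v \<in> set ts" using cycle_edges_ends f(3) v by blast
  then show thesis using that ts by blast
qed

lemma triangle_adjacent:
  assumes "cycle G ts" "length ts = 3" "u \<in> set ts" "v \<in> set ts" "u \<noteq> v"
  shows "v \<in> nbhd G u"
proof -
  obtain p q r where ts: "ts = [p, q, r]"
    using assms(2) by (auto simp: numeral_3_eq_3 length_Suc_conv)
  have "walk G [p, q, r, p]"
    using cycle_walk[OF assms(1)] by (simp add: ts)
  then show ?thesis using assms ts nbhd_sym[of _ G] by auto
qed

lemma mop_plane: "mop G \<Longrightarrow> plane_graph G"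
  by (simp add: mop_def triangulated_disc_def)

text \<open>The exterior boundary contains all vertices, and a vertex on an edge is an end of that edge.\<close>

lemma mop_exterior_cycle:
  assumes "mop G"
  obtains xs where "hamiltonian_cycle G xs" "frontier (exterior_face G) = \<Union> (cycle_edges G xs)"
proof -
  obtain xs where xs: "cycle G xs" "frontier (exterior_face G) = \<Union> (cycle_edges G xs)"
    using assms by (auto simp: mop_def triangulated_disc_def bounded_by_cycle_def)
  have "verts G \<subseteq> set xs"
    using assms xs(2) cycle_edges_ends unfolding mop_def by blast
  then have "set xs = verts G" using xs(1) by (auto simp: cycle_def)
  then show thesis using that xs by (auto simp: hamiltonian_cycle_def)
qed

text \<open>The triangle of an interior face at \<open>v\<close> uses two neighbours of \<open>v\<close>, and there are no
  others.\<close>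

lemma degree_two_neighbours_adjacent:
  assumes "mop G" "v \<in> verts G" "degree G v = 2" "a \<in> nbhd G v" "b \<in> nbhd G v" "a \<noteq> b"
  shows "b \<in> nbhd G a"
proof -
  obtain xs where xs: "cycle G xs" "set xs = verts G"
    by (rule mop_exterior_cycle[OF assms(1)]) (auto simp: hamiltonian_cycle_def)
  have tri: "\<And>F. interior_face G F \<Longrightarrow> \<exists>ts. length ts = 3 \<and> bounded_by_cycle G F ts"
    using assms(1) unfolding mop_def triangulated_disc_def by simp
  have "v \<in> set xs" using xs assms(2) by simp
  then obtain ts where ts: "length ts = 3" "cycle G ts" "v \<in> set ts"
    by (rule triangle_at_cycle_vertex[OF mop_plane[OF assms(1)] xs(1) _ tri])
  have "distinct ts" using ts(2) by (simp add: cycle_def)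
  have "set ts - {v} \<subseteq> nbhd G v"
    using triangle_adjacent[OF ts(2,1,3)] by auto
  moreover have "card (set ts - {v}) = 2"
    using ts(1,3) distinct_card[of ts] \<open>distinct ts\<close> by simp
  moreover have "card (nbhd G v) = 2" using assms(3) unfolding degree_def .
  moreover have "finite (nbhd G v)"
    using \<open>card (nbhd G v) = 2\<close> by (intro card_ge_0_finite) simp
  ultimately have "set ts - {v} = nbhd G v"
    by (intro card_subset_eq) simp_all
  then have "a \<in> set ts" "b \<in> set ts" using assms(4,5) by auto
  then show ?thesis using triangle_adjacent[OF ts(2,1)] assms(6) by simp
qed

section \<open>Dominating a walk by every second vertex\<close>

text \<open>Every second element, beginning with the second, hits all consecutive pairs.\<close>

lemma half_cover:
  "\<exists>S. S \<subseteq> set zs \<and> 2 * card S \<le> length zs \<and> successively (\<lambda>a b. a \<in> S \<or> b \<in> S) zs"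
proof (induction zs rule: induct_list012)
  case (3 a b zs)
  then obtain S where S: "S \<subseteq> set zs" "2 * card S \<le> length zs"
    "successively (\<lambda>a b. a \<in> S \<or> b \<in> S) zs" by (elim exE conjE)
  have "successively (\<lambda>a b'. a \<in> insert b S \<or> b' \<in> insert b S) zs"
    by (rule successively_mono[OF S(3)]) auto
  then have "successively (\<lambda>a b'. a \<in> insert b S \<or> b' \<in> insert b S) (a # b # zs)"
    by (simp only: successively_Cons insertI1 list.sel simp_thms)
  moreover have "card (insert b S) \<le> Suc (card S)" by (rule card_insert_le_m1) simp_all
  then have "2 * card (insert b S) \<le> length (a # b # zs)" using S(2) by simp
  moreover have "insert b S \<subseteq> set (a # b # zs)" using S(1) by auto
  ultimately show ?case by (intro exI[of _ "insert b S"] conjI)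
qed auto

text \<open>Here and below \<open>P\<close> marks the vertices that are skipped (later: those of degree two).
  Around a skipped vertex the walk can take a short cut, so the remaining vertices still form a
  walk. Equality is allowed in the conclusion because a walk may go back to where it came from.\<close>

lemma walk_shortcuts:
  assumes "successively R ws" "ws \<noteq> [] \<Longrightarrow> \<not> P (hd ws) \<and> \<not> P (last ws)"
    and "\<And>a y b. P y \<Longrightarrow> R a y \<Longrightarrow> R y b \<Longrightarrow> \<not> P b \<and> (a = b \<or> R a b)"
  shows "successively (\<lambda>a b. a = b \<or> R a b) (filter (\<lambda>x. \<not> P x) ws)"
  using assms(1,2)
proof (induction ws rule: induct_list012)
  case (3 a y ws)
  show ?case
  proof (cases "P y")
    case False
    then have "successively (\<lambda>a b. a = b \<or> R a b) (filter (\<lambda>x. \<not> P x) (y # ws))"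
      using 3 by auto
    then show ?thesis using False 3 by auto
  next
    case True
    then obtain b us where ws: "ws = b # us" using 3 by (cases ws) auto
    have b: "\<not> P b \<and> (a = b \<or> R a b)"
      using assms(3)[of y a b] True 3(3) unfolding ws by simp
    have "successively (\<lambda>a b. a = b \<or> R a b) (filter (\<lambda>x. \<not> P x) ws)"
      using 3 b unfolding ws by auto
    then show ?thesis using True b 3 unfolding ws by auto
  qed
qed auto

text \<open>A skipped vertex stands between two consecutive remaining vertices, one of which is in \<open>S\<close>.\<close>

lemma skipped_dominated:
  assumes "successively R ws" "ws \<noteq> [] \<Longrightarrow> \<not> P (hd ws) \<and> \<not> P (last ws)"
    and "\<And>a y b. P y \<Longrightarrow> R a y \<Longrightarrow> R y b \<Longrightarrow> \<not> P b"
    and "successively (\<lambda>a b. a \<in> S \<or> b \<in> S) (filter (\<lambda>x. \<not> P x) ws)"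
    and "v \<in> set ws" "P v"
  shows "\<exists>u\<in>S. R u v \<or> R v u"
  using assms(1,2,4,5)
proof (induction ws rule: induct_list012)
  case (3 a y ws)
  show ?case
  proof (cases "P y")
    case False
    then show ?thesis using 3 assms(6) by auto
  next
    case True
    then obtain b us where ws: "ws = b # us" using 3 by (cases ws) auto
    have b: "\<not> P b"
      using assms(3)[of y a b] True 3(3) unfolding ws by simp
    have "a \<in> S \<or> b \<in> S" using 3 b True unfolding ws by auto
    moreover have "\<exists>u\<in>S. R u v \<or> R v u" if "v \<in> set ws"
      using 3 b True that unfolding ws by auto
    moreover have "v \<noteq> a" using 3 assms(6) by auto
    ultimately show ?thesis using 3 unfolding ws by auto
  qed
qed (use assms(6) in auto)

lemma successively_neighbour:
  assumes "successively Q zs" "2 \<le> length zs" "z \<in> set zs"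
  shows "\<exists>y\<in>set zs. Q y z \<or> Q z y"
proof -
  obtain i where i: "i < length zs" "z = zs ! i" using assms(3) by (auto simp: in_set_conv_nth)
  show ?thesis
  proof (cases i)
    case 0
    then have "Q z (zs ! 1)" "zs ! 1 \<in> set zs" using assms(1,2) i by (auto simp: successively_conv_nth)
    then show ?thesis by blast
  next
    case (Suc j)
    then have "Q (zs ! j) z" "zs ! j \<in> set zs" using assms(1) i by (auto simp: successively_conv_nth)
    then show ?thesis by blast
  qed
qed

text \<open>A set that hits all consecutive pairs of remaining vertices dominates those vertices along the
  shortened walk, and it dominates each skipped vertex because its two neighbours on the original
  walk form such a pair.\<close>

lemma dominating_half:
  assumes "successively R ws" "\<not> P (hd ws)" "\<not> P (last ws)" and sym: "\<And>a b. R a b \<Longrightarrow> R b a"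
    and "\<And>a y b. P y \<Longrightarrow> R a y \<Longrightarrow> R y b \<Longrightarrow> \<not> P b \<and> (a = b \<or> R a b)"
    and "2 \<le> length (filter (\<lambda>x. \<not> P x) ws)"
  obtains S where "S \<subseteq> set ws" "2 * card S \<le> length (filter (\<lambda>x. \<not> P x) ws)"
    "\<And>v. v \<in> set ws - S \<Longrightarrow> \<exists>u\<in>S. R v u"
proof -
  define zs where "zs = filter (\<lambda>x. \<not> P x) ws"
  obtain S where S: "S \<subseteq> set zs" "2 * card S \<le> length zs"
    "successively (\<lambda>a b. a \<in> S \<or> b \<in> S) zs"
    using half_cover[of zs] by (elim exE conjE)
  have adj: "successively (\<lambda>a b. a = b \<or> R a b) zs"
    unfolding zs_def by (rule walk_shortcuts) (use assms(1-3,5) in auto)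
  have both: "successively (\<lambda>a b. (a \<in> S \<or> b \<in> S) \<and> (a = b \<or> R a b)) zs"
    using S(3) adj by (auto simp: successively_conv_nth)
  have "\<exists>u\<in>S. R v u" if v: "v \<in> set ws - S" for v
  proof (cases "P v")
    case True
    have "\<exists>u\<in>S. R u v \<or> R v u"
      by (rule skipped_dominated[of R ws P S v]) (use assms(1-3,5) S(3) v True zs_def in auto)
    then show ?thesis using sym by blast
  next
    case False
    then have "v \<in> set zs" using v by (simp add: zs_def)
    then have "\<exists>u\<in>set zs. ((u \<in> S \<or> v \<in> S) \<and> (u = v \<or> R u v)) \<or> ((v \<in> S \<or> u \<in> S) \<and> (v = u \<or> R v u))"
      using assms(6) by (intro successively_neighbour[OF both]) (simp_all add: zs_def)
    then show ?thesis using v by (elim bexE) (auto dest: sym)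
  qed
  moreover have "S \<subseteq> set ws" using S(1) by (auto simp: zs_def)
  ultimately show thesis using that S(2) unfolding zs_def by simp
qed

section \<open>The upper bound\<close>

lemma finite_dominating:
  assumes "plane_graph G"
  shows "finite {S. dominating G S}"
  by (rule finite_subset[of _ "Pow (verts G)"])
     (use assms in \<open>auto simp: dominating_def plane_graph_def\<close>)

lemma domination_number_le:
  assumes "plane_graph G" "dominating G S"
  shows "domination_number G \<le> card S"
  unfolding domination_number_def
  by (rule Min_le) (use finite_dominating assms in auto)

lemma domination_number_attained:
  assumes "plane_graph G"
  obtains S where "dominating G S" "card S = domination_number G"
proof -
  have "dominating G (verts G)" by (simp add: dominating_def)
  then have "domination_number G \<in> card ` {S. dominating G S}"
    unfolding domination_number_def using finite_dominating[OF assms] by (intro Min_in) auto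
  then show thesis using that by auto
qed

text \<open>If \<open>v\<close> and its neighbour \<open>u\<close> both had degree two, then \<open>u\<close>, \<open>v\<close> and the other
  neighbour of \<open>v\<close> would form a triangle containing all neighbours of \<open>u\<close> and \<open>v\<close>, and the
  Hamiltonian cycle could not leave it except through one vertex.\<close>

lemma degree_two_not_adjacent:
  assumes G: "mop G" and n: "4 \<le> order G" and v: "v \<in> verts G" "degree G v = 2"
    and u: "u \<in> nbhd G v"
  shows "degree G u \<noteq> 2"
proof
  assume du: "degree G u = 2"
  obtain ys where ys: "cycle G ys" "set ys = verts G"
    by (rule mop_exterior_cycle[OF G]) (auto simp: hamiltonian_cycle_def)
  obtain k where k: "k < length ys" "ys ! k = v"
    using v(1) in_set_conv_nth[of v ys] unfolding ys(2) by blast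
  \<comment> \<open>Rotating by \<open>k - 1\<close> modulo the length places \<open>v\<close> at index 1, with both its neighbours in view.\<close>
  define xs where "xs = rotate (k + (length ys - 1)) ys"
  have xs: "cycle G xs" "set xs = verts G"
    using cycle_rotate[OF ys(1)] ys(2) by (auto simp: xs_def)
  have dist: "distinct xs" using xs(1) by (simp add: cycle_def)
  then have len: "4 \<le> length xs"
    using n distinct_card[of xs] by (simp add: order_def xs(2))
  have "length xs = length ys" by (simp add: xs_def)
  moreover have "k + (length ys - 1) + 1 = k + length ys" using k(1) by simp
  ultimately have "xs ! 1 = v"
    using k len by (simp add: xs_def nth_rotate del: One_nat_def)
  then obtain a b c zs where abc: "xs = a # v # b # c # zs"
    using len by (auto simp: numeral_eq_Suc Suc_le_length_iff)
  have w: "walk G (xs @ [a])" using cycle_walk[OF xs(1)] by (simp add: abc)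
  have edge: "v \<in> nbhd G a" "b \<in> nbhd G v" "c \<in> nbhd G b"
    using w by (simp_all add: abc)
  define d where "d = last (c # zs)"
  have d: "a \<in> nbhd G d" "d \<in> set (c # zs)"
    using w by (auto simp: abc d_def successively_append_iff successively_Cons)
  have two: "nbhd G x = {p, q}" if "degree G x = 2" "p \<in> nbhd G x" "q \<in> nbhd G x" "p \<noteq> q" for x p q
  proof -
    have "card (nbhd G x) = 2" using that(1) unfolding degree_def .
    moreover from this have "finite (nbhd G x)" by (intro card_ge_0_finite) simp
    ultimately have "{p, q} = nbhd G x" using that by (intro card_subset_eq) auto
    then show ?thesis by (rule sym)
  qed
  have Nv: "nbhd G v = {a, b}"
    using two[OF v(2)] edge dist nbhd_sym[of v G a] by (auto simp: abc)
  have ab: "b \<in> nbhd G a"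
    using degree_two_neighbours_adjacent[OF G v, of a b] Nv dist by (auto simp: abc)
  from u Nv consider "u = a" | "u = b" by blast
  then show False
  proof cases
    case 1
    then have "nbhd G a = {v, b}" using two[of a v b] du edge(1) ab dist by (auto simp: abc)
    then have "d \<in> {v, b}" using d(1) nbhd_sym[of a G d] by blast
    then show False using d(2) dist by (auto simp: abc)
  next
    case 2
    then have "nbhd G b = {v, a}"
      using two[of b v a] du edge(2) ab dist nbhd_sym[of b G v] nbhd_sym[of b G a] by (auto simp: abc)
    then show False using edge(3) dist by (auto simp: abc)
  qed
qed

lemma dominating_along_walk:
  assumes G: "mop G" and n: "4 \<le> order G" and ws: "walk G ws" "set ws = verts G"
    and "degree G (hd ws) \<noteq> 2" "degree G (last ws) \<noteq> 2"
    and m: "2 \<le> length (filter (\<lambda>x. degree G x \<noteq> 2) ws)"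
  shows "2 * domination_number G \<le> length (filter (\<lambda>x. degree G x \<noteq> 2) ws)"
proof -
  define P where "P = (\<lambda>x. degree G x = 2)"
  have skip: "\<not> P b \<and> (a = b \<or> b \<in> nbhd G a)"
    if "P y" "y \<in> nbhd G a" "b \<in> nbhd G y" for a y b
  proof -
    have y: "y \<in> verts G" "degree G y = 2" using that nbhd_subset_verts by (auto simp: P_def)
    have "a \<in> nbhd G y" using that(2) nbhd_sym by simp
    then show ?thesis
      using degree_two_not_adjacent[OF G n y that(3)] degree_two_neighbours_adjacent[OF G y _ that(3)]
      by (auto simp: P_def)
  qed
  obtain S where S: "S \<subseteq> set ws" "2 * card S \<le> length (filter (\<lambda>x. \<not> P x) ws)"
    "\<And>v. v \<in> set ws - S \<Longrightarrow> \<exists>u\<in>S. u \<in> nbhd G v"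
  proof (rule dominating_half[of "\<lambda>u v. v \<in> nbhd G u" ws P])
    show "2 \<le> length (filter (\<lambda>x. \<not> P x) ws)" using m by (simp add: P_def)
    show "a \<in> nbhd G b" if "b \<in> nbhd G a" for a b using that nbhd_sym by simp
    show "walk G ws" by (rule ws(1))
    show "\<not> P (hd ws)" "\<not> P (last ws)" using assms(5,6) by (simp_all add: P_def)
    show "\<not> P b \<and> (a = b \<or> b \<in> nbhd G a)"
      if "P y" "y \<in> nbhd G a" "b \<in> nbhd G y" for a y b
      using that by (rule skip)
  qed (rule that)
  have "dominating G S"
    unfolding dominating_def
  proof (intro conjI ballI)
    show "S \<subseteq> verts G" using S(1) ws(2) by simp
    show "nbhd G v \<inter> S \<noteq> {}" if "v \<in> verts G - S" for v
      using S(3)[of v] that ws(2) by auto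
  qed
  then have "domination_number G \<le> card S"
    by (rule domination_number_le[OF mop_plane[OF G]])
  then show ?thesis using S(2) by (simp add: P_def)
qed

text \<open>Vertices of degree two are never consecutive on the Hamiltonian cycle, so at most half of all
  vertices have degree two. If it is exactly half, they alternate with the others; the cycle is then
  closed up to a walk that visits its first vertex twice. Otherwise two other vertices are consecutive,
  and cutting the cycle between them gives a walk without repetition, saving the half vertex that
  the closed walk may waste.\<close>

lemma domination_number_upper:
  assumes G: "mop G" and n: "4 \<le> order G"
  defines "n2 \<equiv> card {v \<in> verts G. degree G v = 2}"
  shows "n2 + 2 * domination_number G \<le> order G + ind (order G) n2"
proof -
  define P where "P = (\<lambda>x. degree G x = 2)"
  obtain xs where xs: "cycle G xs" "set xs = verts G"
    by (rule mop_exterior_cycle[OF G]) (auto simp: hamiltonian_cycle_def)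
  have dist: "distinct xs" using xs(1) by (simp add: cycle_def)
  define N where "N = length xs"
  have N: "order G = N" using distinct_card[OF dist] by (simp add: N_def order_def xs(2))
  have xne: "xs \<noteq> []" using n N by (auto simp: N_def)
  define I where "I = {i. i < N \<and> P (xs ! i)}"
  define J where "J = {i. i < N \<and> \<not> P (xs ! i)}"
  define s where "s = (\<lambda>i. Suc i mod N)"
  have "0 < N" using n N by simp
  then have s: "s i < N" "xs ! s i \<in> nbhd G (xs ! i)" if "i < N" for i
    using xs(1) that by (simp_all add: s_def cycle_def flip: N_def)
  have PP: "\<not> P (xs ! s i)" if "i < N" "P (xs ! i)" for i
  proof -
    have "xs ! i \<in> verts G" using nth_mem[of i xs] that(1) xs(2) by (simp add: N_def)
    then show ?thesis
      using degree_two_not_adjacent[OF G n _ _ s(2)[OF that(1)]] that(2) by (simp add: P_def)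
  qed
  have inj: "inj_on s {..<N}"
    by (auto simp: inj_on_def s_def mod_Suc split: if_splits)
  have IJ: "I \<union> J = {..<N}" "I \<inter> J = {}" by (auto simp: I_def J_def)
  have fin: "finite I" "finite J" by (auto simp: I_def J_def)
  have cardIJ: "card I + card J = N"
    using card_Un_disjoint[OF fin IJ(2)] IJ(1) by simp
  have cI: "card I = n2"
  proof -
    have "{v \<in> verts G. P v} = (!) xs ` I"
      unfolding xs(2)[symmetric] I_def N_def by (auto simp: in_set_conv_nth)
    moreover have "inj_on ((!) xs) I"
      using dist by (auto simp: inj_on_def I_def N_def nth_eq_iff_index_eq)
    ultimately show ?thesis unfolding n2_def P_def by (simp add: card_image)
  qed
  have lenf: "length (filter (\<lambda>x. degree G x \<noteq> 2) ys) = card J"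
    if "distinct ys" "set ys = verts G" for ys
  proof -
    have "length (filter (\<lambda>x. \<not> P x) ys) = card {v \<in> verts G. \<not> P v}"
      using distinct_card[of "filter (\<lambda>x. \<not> P x) ys"] that by simp
    also have "\<dots> = length (filter (\<lambda>x. \<not> P x) xs)"
      using distinct_card[of "filter (\<lambda>x. \<not> P x) xs"] dist xs(2) by simp
    also have "\<dots> = card J"
      by (simp add: length_filter_conv_card J_def N_def)
    finally show ?thesis by (simp add: P_def)
  qed
  have "s ` I \<subseteq> J" using PP s by (auto simp: I_def J_def)
  moreover have "inj_on s I" by (rule inj_on_subset[OF inj]) (auto simp: I_def)
  ultimately have le: "card I \<le> card J"
    using fin by (intro card_inj_on_le[of s])
  have J2: "2 \<le> card J" using le cardIJ n unfolding N by simp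
  have rot: "cycle G (rotate k xs)" "distinct (rotate k xs)" "set (rotate k xs) = verts G" for k
    by (rule cycle_rotate[OF xs(1)]) (simp_all add: dist xs(2))
  show ?thesis
  proof (cases "card I = card J")
    case True
    \<comment> \<open>The closed walk counts its first vertex twice, giving \<open>(card J + 1) div 2\<close>; for odd \<open>card J\<close> this
      is where the indicator term comes from.\<close>
    have "J \<noteq> {}" using J2 by auto
    then obtain j where j: "j < N" "\<not> P (xs ! j)"
      by (auto simp: J_def)
    define ys where "ys = rotate j xs"
    have hd: "hd ys = xs ! j"
      using j(1) hd_rotate_conv_nth[OF xne] by (simp add: ys_def N_def)
    have ne: "ys \<noteq> []" using xne by (simp add: ys_def)
    have setws: "set (ys @ [hd ys]) = verts G"
      using rot(3)[of j] ne hd_in_set[OF ne] by (simp add: ys_def insert_absorb)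
    have ends: "degree G (hd (ys @ [hd ys])) \<noteq> 2" "degree G (last (ys @ [hd ys])) \<noteq> 2"
      using ne hd j(2) by (simp_all add: P_def)
    have "length (filter (\<lambda>x. degree G x \<noteq> 2) ys) = card J"
      unfolding ys_def by (rule lenf[OF rot(2,3)])
    then have len: "length (filter (\<lambda>x. degree G x \<noteq> 2) (ys @ [hd ys])) = Suc (card J)"
      using ends(2) by simp
    have "walk G (ys @ [hd ys])" unfolding ys_def by (rule cycle_walk[OF rot(1)])
    from dominating_along_walk[OF G n this setws ends]
    have "2 * domination_number G \<le> Suc (card J)"
      unfolding len using J2 by simp
    moreover have "card J = n2" and N2: "order G = 2 * n2"
      using cardIJ cI True N by simp_all
    ultimately have half: "2 * domination_number G \<le> Suc n2" by simp
    show ?thesis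
    proof (cases "odd n2")
      case True
      then have "ind (order G) n2 = 1" unfolding N2 ind_def by simp
      then show ?thesis using half N2 by linarith
    next
      case False
      then have "2 * domination_number G \<noteq> Suc n2" by (metis even_Suc dvd_triv_left)
      then show ?thesis using half N2 by linarith
    qed
  next
    case False
    \<comment> \<open>Otherwise the successor map would inject \<open>J\<close> into the smaller set \<open>I\<close>.\<close>
    have "\<not> s ` J \<subseteq> I"
    proof
      assume "s ` J \<subseteq> I"
      moreover have "inj_on s J" by (rule inj_on_subset[OF inj]) (auto simp: J_def)
      ultimately have "card J \<le> card I"
        using fin by (intro card_inj_on_le[of s])
      then show False using le False by simp
    qed
    then obtain i where i: "i < N" "\<not> P (xs ! i)" "\<not> P (xs ! s i)"
      using s by (auto simp: I_def J_def)
    define ys where "ys = rotate (Suc i) xs"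
    have "length ys = N" "0 < N" using i by (auto simp: ys_def N_def)
    then have ne: "ys \<noteq> []" by auto
    have "hd ys = xs ! s i"
      using hd_rotate_conv_nth[OF xne] by (simp add: ys_def N_def s_def del: rotate_Suc)
    then have "degree G (hd ys) \<noteq> 2" using i(3) by (simp add: P_def)
    moreover have "last ys = xs ! i"
    proof -
      have "last ys = ys ! (N - 1)" using ne \<open>length ys = N\<close> by (simp add: last_conv_nth)
      also have "\<dots> = xs ! ((Suc i + (N - 1)) mod N)"
        unfolding ys_def N_def using \<open>0 < N\<close> by (intro nth_rotate) (simp add: N_def)
      also have "(Suc i + (N - 1)) mod N = i" using i(1) by simp
      finally show ?thesis .
    qed
    then have "degree G (last ys) \<noteq> 2" using i(2) by (simp add: P_def)
    moreover have len: "length (filter (\<lambda>x. degree G x \<noteq> 2) ys) = card J"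
      unfolding ys_def by (rule lenf[OF rot(2,3)])
    moreover have "walk G ys"
      using cycle_walk[OF rot(1)] unfolding ys_def successively_append_iff by blast
    moreover have "set ys = verts G" unfolding ys_def by (rule rot(3))
    ultimately have "2 * domination_number G \<le> card J"
      using dominating_along_walk[OF G n, of ys] J2 by simp
    then show ?thesis using cardIJ cI N by simp
  qed
qed

section \<open>The two chords of an exterior 4-cycle\<close>

lemma closure_arc_endless:
  assumes "arc g"
  shows "pathfinish g \<in> closure (path_image g - {pathstart g, pathfinish g})"
    and "pathstart g \<in> closure (path_image g - {pathstart g, pathfinish g})"
proof -
  have "g ` closure {0<..<1} \<subseteq> closure (g ` {0<..<1})"
    using assms by (intro continuous_image_closure_subset) (auto simp: arc_def path_def)
  then have "g ` {0..1} \<subseteq> closure (path_image g - {pathstart g, pathfinish g})"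
    using simple_path_endless[OF arc_imp_simple_path[OF assms]] by simp
  then show "pathfinish g \<in> closure (path_image g - {pathstart g, pathfinish g})"
    and "pathstart g \<in> closure (path_image g - {pathstart g, pathfinish g})"
    by (auto simp: pathfinish_def pathstart_def)
qed

text \<open>The outside of the curve is connected and contains the exterior face. If it were larger, it
  would meet the frontier of that face, which is the curve itself.\<close>

lemma exterior_face_eq_outside:
  assumes G: "plane_graph G" and J: "simple_path c" "pathfinish c = pathstart c"
    "path_image c \<subseteq> points G" and fr: "frontier (exterior_face G) = path_image c"
  shows "exterior_face G = outside (path_image c)"
proof -
  have sub: "exterior_face G \<subseteq> outside (path_image c)"
    unfolding exterior_face_def by (rule outside_mono[OF J(3)])
  have "exterior_face G \<noteq> {}"
    using exterior_face_in_faces(2)[OF G] by auto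
  moreover have "connected (outside (path_image c))"
    using Jordan_inside_outside[OF J(1,2)] by blast
  moreover have "outside (path_image c) \<inter> frontier (exterior_face G) = {}"
    unfolding fr using outside_no_overlap by blast
  ultimately have "outside (path_image c) - exterior_face G = {}"
    using connected_Int_frontier[of "outside (path_image c)" "exterior_face G"] sub by blast
  then show ?thesis using sub by blast
qed

lemma walk_edges_disjointI:
  assumes "\<And>e. e \<in> walk_edges G xs \<Longrightarrow> \<not> ends G e \<subseteq> set ys"
  shows "walk_edges G xs \<inter> walk_edges G ys = {}"
  using assms ends_walk_edges by blast

text \<open>Both chords would run inside the Jordan curve of the 4-cycle. The chord from \<open>a\<close> to \<open>c\<close> splits
  this inside into two parts, one next to \<open>b\<close> and one next to \<open>d\<close>. The other chord
  lies in one of the parts, away from its end in the other.\<close>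

lemma exterior_four_cycle_not_both_chords:
  assumes G: "plane_graph G" and cyc: "cycle G [a, b, c, d]"
    and fr: "frontier (exterior_face G) = \<Union> (cycle_edges G [a, b, c, d])"
    and ac: "c \<in> nbhd G a" and bd: "d \<in> nbhd G b"
  shows False
proof -
  have dist: "distinct [a, b, c, d]" using cyc by (simp add: cycle_def)
  have w: "b \<in> nbhd G a" "c \<in> nbhd G b" "d \<in> nbhd G c" "a \<in> nbhd G d"
    using cycle_walk[OF cyc] by simp_all
  have sym: "v \<in> nbhd G u \<Longrightarrow> u \<in> nbhd G v" for u v using nbhd_sym by simp
  obtain p where p: "arc p" "pathstart p = a" "pathfinish p = c"
    "path_image p = \<Union> (walk_edges G [a, b, c])"
    by (rule arc_along_walk[OF G, of "[a, b, c]"]) (use w dist in auto)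
  obtain q where q: "arc q" "pathstart q = a" "pathfinish q = c"
    "path_image q = \<Union> (walk_edges G [a, d, c])"
    by (rule arc_along_walk[OF G, of "[a, d, c]"]) (use w[THEN sym] dist in auto)
  obtain g where g: "arc g" "pathstart g = a" "pathfinish g = c"
    "path_image g = \<Union> (walk_edges G [a, c])"
    by (rule arc_along_walk[OF G, of "[a, c]"]) (use ac dist in auto)
  obtain h where h: "arc h" "pathstart h = b" "pathfinish h = d"
    "path_image h = \<Union> (walk_edges G [b, d])"
    by (rule arc_along_walk[OF G, of "[b, d]"]) (use bd dist in auto)
  have disjoint: "walk_edges G [a, b, c] \<inter> walk_edges G [a, d, c] = {}"
    "walk_edges G [a, b, c] \<inter> walk_edges G [a, c] = {}"
    "walk_edges G [a, d, c] \<inter> walk_edges G [a, c] = {}"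
    "walk_edges G [a, b, c] \<inter> walk_edges G [b, d] = {}"
    "walk_edges G [a, d, c] \<inter> walk_edges G [b, d] = {}"
    "walk_edges G [a, c] \<inter> walk_edges G [b, d] = {}"
    by (rule walk_edges_disjointI; use dist in auto)+
  have ends: "a \<in> path_image p" "c \<in> path_image p" "a \<in> path_image q" "c \<in> path_image q"
    "a \<in> path_image g" "c \<in> path_image g"
    using p q g pathstart_in_path_image pathfinish_in_path_image by metis+
  have pq: "path_image p \<inter> path_image q = {a, c}"
    using walks_meet[OF G disjoint(1)] ends dist unfolding p(4)[symmetric] q(4)[symmetric] by auto
  have pg: "path_image p \<inter> path_image g = {a, c}"
    using walks_meet[OF G disjoint(2)] ends dist unfolding p(4)[symmetric] g(4)[symmetric] by auto
  have qg: "path_image q \<inter> path_image g = {a, c}"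
    using walks_meet[OF G disjoint(3)] ends dist unfolding q(4)[symmetric] g(4)[symmetric] by auto
  have ph: "path_image p \<inter> path_image h \<subseteq> {b}"
    using walks_meet[OF G disjoint(4)] dist unfolding p(4)[symmetric] h(4)[symmetric] by auto
  have qh: "path_image q \<inter> path_image h \<subseteq> {d}"
    using walks_meet[OF G disjoint(5)] dist unfolding q(4)[symmetric] h(4)[symmetric] by auto
  have gh: "path_image g \<inter> path_image h = {}"
    using walks_meet[OF G disjoint(6)] dist unfolding g(4)[symmetric] h(4)[symmetric] by auto
  define J where "J = path_image p \<union> path_image q"
  define r where "r = p +++ reversepath q"
  have r: "simple_path r" "pathfinish r = pathstart r" "path_image r = J"
  proof -
    show "simple_path r"
      unfolding r_def using p(1-3) q(1-3) pq
      by (intro simple_path_join_loop) (simp_all add: arc_reversepath)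
  qed (use p(1-3) q(1-3) in \<open>simp_all add: r_def J_def path_image_join\<close>)
  have "cycle_edges G [a, b, c, d] = walk_edges G [a, b, c] \<union> walk_edges G [a, d, c]"
  proof -
    have "cycle_edges G [a, b, c, d] = {e \<in> edges G. ends G e = {a, b} \<or> ends G e = {b, c} \<or>
        ends G e = {d, c} \<or> ends G e = {a, d}}"
      unfolding insert_commute[of d c] insert_commute[of a d]
      by (simp add: cycle_edges_def Ex_less_Suc2)
    then show ?thesis by auto
  qed
  then have frJ: "frontier (exterior_face G) = path_image r"
    unfolding fr r(3) J_def p(4) q(4) by simp
  have pts: "path_image p \<subseteq> points G" "path_image q \<subseteq> points G" "path_image g \<subseteq> points G"
    "path_image h \<subseteq> points G"
    unfolding p(4) q(4) g(4) h(4) points_def using walk_edges_subset[of G] by blast+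
  have "exterior_face G = outside J"
    using exterior_face_eq_outside[OF G r(1,2) _ frJ] pts r(3) by (simp add: J_def)
  then have "points G \<inter> outside J = {}"
    unfolding exterior_face_def using outside_no_overlap[of "points G"] by (simp add: Int_commute)
  then have inJ: "points G \<subseteq> J \<union> inside J"
    by (auto simp: outside_inside)
  have chord: "path_image g \<inter> inside (path_image p \<union> path_image q) \<noteq> {}"
  proof -
    obtain z where z: "z \<in> path_image g" "z \<noteq> a" "z \<noteq> c"
      using nonempty_simple_path_endless[OF arc_imp_simple_path[OF g(1)]] g(2,3) by blast
    then have "z \<notin> J" using pg qg by (auto simp: J_def)
    then show ?thesis using z(1) inJ pts(3) by (auto simp: J_def)
  qed
  have "a \<noteq> c" using dist by simp
  obtain split: "inside (path_image p \<union> path_image g) \<inter> inside (path_image q \<union> path_image g) = {}"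
      "inside (path_image p \<union> path_image g) \<union> inside (path_image q \<union> path_image g) \<union>
        (path_image g - {a, c}) = inside (path_image p \<union> path_image q)"
    by (rule split_inside_simple_closed_curve[OF
          arc_imp_simple_path[OF p(1)] p(2,3) arc_imp_simple_path[OF q(1)] q(2,3)
          arc_imp_simple_path[OF g(1)] g(2,3) \<open>a \<noteq> c\<close> pq pg qg chord])
  \<comment> \<open>The two parts, and the second chord without its ends, which has to lie in one of them.\<close>
  define A where "A = inside (path_image p \<union> path_image g)"
  define B where "B = inside (path_image q \<union> path_image g)"
  define H where "H = path_image h - {b, d}"
  have H: "connected H" "H \<noteq> {}"
    unfolding H_def using connected_simple_path_endless[of h] nonempty_simple_path_endless[of h]
      arc_imp_simple_path[OF h(1)] h(2,3) by auto
  have clos: "d \<in> closure H" "b \<in> closure H"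
    using closure_arc_endless[OF h(1)] h(2,3) by (simp_all add: H_def)
  have closed: "closed (path_image p \<union> path_image g)" "closed (path_image q \<union> path_image g)"
    using p(1) g(1) q(1) by (simp_all add: closed_Un closed_arc_image)
  then have "open A" "open B" unfolding A_def B_def by (auto intro: open_inside)
  moreover have "H \<inter> J = {}" using ph qh by (auto simp: H_def J_def)
  then have "H \<subseteq> inside J" using inJ pts(4) by (auto simp: H_def)
  then have "H \<subseteq> A \<union> B" using split(2) gh by (auto simp: A_def B_def J_def H_def)
  moreover have "A \<inter> B = {}" using split(1) by (simp add: A_def B_def)
  ultimately have "A \<inter> H = {} \<or> B \<inter> H = {}"
    using H(1) unfolding connected_def by blast
  then have side: "H \<subseteq> A \<or> H \<subseteq> B" using \<open>H \<subseteq> A \<union> B\<close> by blast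
  have "set [a, b, c] \<subseteq> path_image p"
    unfolding p(4) by (rule set_subset_walk_edges) (use w in simp_all)
  moreover have "set [a, d, c] \<subseteq> path_image q"
    unfolding q(4) by (rule set_subset_walk_edges) (use sym[OF w(3)] sym[OF w(4)] in simp_all)
  ultimately have bp: "b \<in> path_image p" and dq: "d \<in> path_image q" by simp_all
  have bh: "b \<in> path_image h" "d \<in> path_image h"
    using h(2,3) pathstart_in_path_image[of h] pathfinish_in_path_image[of h] by auto
  moreover have "d \<noteq> b" using dist by auto
  ultimately have notin: "d \<notin> path_image p \<union> path_image g" "b \<notin> path_image q \<union> path_image g"
    using ph qh gh by auto
  have "inside J \<inter> J = {}" using inside_no_overlap by blast
  then have "b \<notin> A \<union> B" "d \<notin> A \<union> B"
    using split(2) bp dq unfolding A_def B_def J_def by blast+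
  moreover have "closure A \<subseteq> path_image p \<union> path_image g \<union> A"
    "closure B \<subseteq> path_image q \<union> path_image g \<union> B"
    unfolding A_def B_def using closure_inside_subset closed by blast+
  ultimately show False
    using side clos notin closure_mono[of H A] closure_mono[of H B] by blast
qed

text \<open>At most one of the two chords of the Hamiltonian 4-cycle is an edge; the ends of the other
  chord have degree two.\<close>

lemma order_four_degree_two:
  assumes G: "mop G" and n: "order G = 4"
  shows "2 \<le> card {v \<in> verts G. degree G v = 2}"
proof -
  obtain xs where xs: "cycle G xs" "set xs = verts G"
    "frontier (exterior_face G) = \<Union> (cycle_edges G xs)"
    by (rule mop_exterior_cycle[OF G]) (auto simp: hamiltonian_cycle_def)
  have dist: "distinct xs" using xs(1) by (simp add: cycle_def)
  have "length xs = 4" using distinct_card[OF dist] n by (simp add: order_def xs(2))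
  then obtain a b c d where abcd: "xs = [a, b, c, d]"
    by (auto simp: numeral_eq_Suc length_Suc_conv)
  note cyc = xs(1)[unfolded abcd] and fr = xs(3)[unfolded abcd]
  have V: "verts G = {a, b, c, d}" using xs(2) by (simp add: abcd)
  have w: "b \<in> nbhd G a" "c \<in> nbhd G b" "d \<in> nbhd G c" "a \<in> nbhd G d"
    using cycle_walk[OF cyc] by simp_all
  have sym: "v \<in> nbhd G u \<Longrightarrow> u \<in> nbhd G v" for u v using nbhd_sym by simp
  have irr: "v \<notin> nbhd G v" for v by (rule nbhd_irrefl[OF mop_plane[OF G]])
  have sub: "nbhd G v \<subseteq> {a, b, c, d}" for v using nbhd_subset_verts[of G v] V by simp
  have fin: "finite {v \<in> verts G. degree G v = 2}" using V by simp
  have "c \<notin> nbhd G a \<or> d \<notin> nbhd G b"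
    using exterior_four_cycle_not_both_chords[OF mop_plane[OF G] cyc fr] by blast
  then show ?thesis
  proof
    assume no: "c \<notin> nbhd G a"
    have "nbhd G a = {b, d}" using sub[of a] irr[of a] no w(1) sym[OF w(4)] by blast
    moreover have "nbhd G c = {b, d}" using sub[of c] irr[of c] no sym sym[OF w(2)] w(3) by blast
    ultimately have "{a, c} \<subseteq> {v \<in> verts G. degree G v = 2}"
      using dist by (auto simp: degree_def V abcd)
    from card_mono[OF fin this] show ?thesis using dist by (simp add: abcd)
  next
    assume no: "d \<notin> nbhd G b"
    have "nbhd G b = {a, c}" using sub[of b] irr[of b] no w(2) sym[OF w(1)] by blast
    moreover have "nbhd G d = {a, c}" using sub[of d] irr[of d] no sym sym[OF w(3)] w(4) by blast
    ultimately have "{b, d} \<subseteq> {v \<in> verts G. degree G v = 2}"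
      using dist by (auto simp: degree_def V abcd)
    from card_mono[OF fin this] show ?thesis using dist by (simp add: abcd)
  qed
qed

section \<open>Lower bounds\<close>

lemma domination_number_pos:
  assumes "plane_graph G" "verts G \<noteq> {}"
  shows "1 \<le> domination_number G"
proof -
  obtain S where S: "dominating G S" "card S = domination_number G"
    by (rule domination_number_attained[OF assms(1)])
  have "S \<noteq> {}" using S(1) assms(2) by (auto simp: dominating_def)
  moreover have "finite S"
    using S(1) assms(1) finite_subset by (auto simp: dominating_def plane_graph_def)
  ultimately show ?thesis using S(2) by (metis One_nat_def Suc_leI card_gt_0_iff)
qed

lemma subgraph_ends:
  assumes "plane_graph G" "plane_graph M" "subgraph M G" "e \<in> edges M"
  shows "ends M e = ends G e"
proof (rule card_subset_eq)
  have e: "e \<in> edges G" using assms(3,4) by (auto simp: subgraph_def)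
  show "card (ends M e) = card (ends G e)"
    using card_ends assms(1,2,4) e by simp
  show "finite (ends G e)" using card_ends[OF assms(1) e] by (intro card_ge_0_finite) simp
  show "ends M e \<subseteq> ends G e" using assms(3) by (auto simp: ends_def subgraph_def)
qed

lemma subgraph_nbhd:
  assumes "plane_graph G" "plane_graph M" "subgraph M G"
  shows "nbhd M v \<subseteq> nbhd G v"
proof
  fix u assume "u \<in> nbhd M v"
  then obtain e where e: "e \<in> edges M" "ends M e = {u, v}" by (auto simp: nbhd_def)
  then have "ends G e = {u, v}" "e \<in> edges G"
    using subgraph_ends[OF assms e(1)] assms(3) by (auto simp: subgraph_def)
  then show "u \<in> nbhd G v" by (auto simp: nbhd_def)
qed

lemma card_fibre_le_1:
  assumes "inj_on f A"
  shows "card {i \<in> A. s = f i} \<le> 1"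
proof (cases "{i \<in> A. s = f i} = {}")
  case False
  then obtain i where "i \<in> A" "s = f i" by blast
  then have "{i \<in> A. s = f i} \<subseteq> {i}" using assms by (auto dest: inj_onD)
  from card_mono[OF _ this] show ?thesis by simp
next
  case True
  then show ?thesis by (simp only: card.empty)
qed

text \<open>An element of \<open>S\<close> serves at most two indices: a \<open>y\<close> only its own, an \<open>x\<close>
  its own and the preceding one.\<close>

lemma cyclic_pairs_cover:
  fixes xs ys :: "'a list"
  assumes S: "finite S" and t: "0 < t"
    and xs: "distinct xs" "length xs = t" and ys: "distinct ys" "length ys = t" "set xs \<inter> set ys = {}"
    and hit: "\<And>i. i < t \<Longrightarrow> S \<inter> {ys ! i, xs ! i, xs ! (Suc i mod t)} \<noteq> {}"
  shows "t \<le> 2 * card S"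
proof -
  define fibre where "fibre = (\<lambda>(f :: nat \<Rightarrow> 'a) s. {i \<in> {..<t}. s = f i})"
  define x y x' where "x = (!) xs" and "y = (!) ys" and "x' = (\<lambda>i. xs ! (Suc i mod t))"
  define I where "I = (\<lambda>s. fibre y s \<union> (fibre x s \<union> fibre x' s))"
  have inj: "inj_on y {..<t}" "inj_on x {..<t}"
    using xs ys by (auto simp: x_def y_def inj_on_def nth_eq_iff_index_eq)
  have "inj_on (\<lambda>i. Suc i mod t) {..<t}"
    by (auto simp: inj_on_def mod_Suc split: if_splits)
  moreover have "(\<lambda>i. Suc i mod t) ` {..<t} \<subseteq> {..<t}" using t by auto
  ultimately have inj': "inj_on x' {..<t}"
    using comp_inj_on[OF _ inj_on_subset[OF inj(2)]] by (simp add: x'_def x_def comp_def)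
  have one: "card (fibre y s) \<le> 1" "card (fibre x s) \<le> 1" "card (fibre x' s) \<le> 1" for s
    unfolding fibre_def by (rule card_fibre_le_1, fact inj inj')+
  have rng: "y i \<in> set ys" "x i \<in> set xs" "x' i \<in> set xs" if "i < t" for i
    using that t xs(2) ys(2) by (simp_all add: x_def y_def x'_def)
  have "card (I s) \<le> 2" for s
  proof (cases "s \<in> set ys")
    case True
    then have "fibre x s = {}" "fibre x' s = {}"
      using rng ys(3) unfolding fibre_def by blast+
    then show ?thesis using one(1)[of s] by (simp add: I_def)
  next
    case False
    then have "fibre y s = {}" using rng unfolding fibre_def by blast
    then show ?thesis
      using one(2,3)[of s] card_Un_le[of "fibre x s" "fibre x' s"] by (simp add: I_def)
  qed
  then have "card (\<Union>s\<in>S. I s) \<le> card S * 2"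
    using order_trans[OF card_UN_le[OF S] sum_bounded_above[of S "\<lambda>s. card (I s)" 2]] by simp
  moreover have "{..<t} \<subseteq> (\<Union>s\<in>S. I s)" 
  proof
    fix i assume "i \<in> {..<t}"
    moreover from this have "S \<inter> {y i, x i, x' i} \<noteq> {}"
      using hit[of i] by (simp add: x_def y_def x'_def)
    then obtain s where "s \<in> S" "s = y i \<or> s = x i \<or> s = x' i" by auto
    ultimately show "i \<in> (\<Union>s\<in>S. I s)" by (auto simp: I_def fibre_def)
  qed
  moreover have "finite (\<Union>s\<in>S. I s)" using S by (auto simp: I_def fibre_def)
  ultimately show ?thesis using card_mono[of "\<Union>s\<in>S. I s" "{..<t}"] by simp
qed

text \<open>Each \<open>x\<^sub>i\<close> has its two neighbours on the cycle of \<open>M\<close> and at least one \<open>y\<close> as neighbours, so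
  that exactly the \<open>y\<^sub>i\<close> have degree two. To dominate \<open>y\<^sub>i\<close>, a set needs one of \<open>y\<^sub>i\<close>,
  \<open>x\<^sub>i\<close> and \<open>x\<^sub>i\<^sub>+\<^sub>1\<close>.\<close>

lemma t_extreme_parameters:
  assumes "t_extreme t G"
  shows "order G = 2 * t" and "card {v \<in> verts G. degree G v = 2} = t"
    and "t \<le> 2 * domination_number G"
proof -
  obtain M xs ys where t: "3 \<le> t" and G: "mop G" and M: "subgraph M G" "mop M"
    and xs: "hamiltonian_cycle M xs" "length xs = t"
    and ys: "length ys = t" "distinct ys" "set ys \<subseteq> verts G \<inter> exterior_face M"
    and N: "\<forall>i<t. nbhd G (ys ! i) = {xs ! i, xs ! (Suc i mod t)}"
    and V: "verts G = verts M \<union> set ys"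
    using assms unfolding t_extreme_def by (elim conjE exE)
  note pG = mop_plane[OF G] and pM = mop_plane[OF M(2)]
  have cyc: "cycle M xs" and dist: "distinct xs" and VM: "verts M = set xs"
    using xs(1) by (auto simp: hamiltonian_cycle_def cycle_def)
  have "exterior_face M \<inter> points M = {}"
    unfolding exterior_face_def using outside_no_overlap by blast
  then have disj: "set xs \<inter> set ys = {}"
    using ys(3) by (auto simp: points_def VM)
  have cx: "card (set xs) = t" and cy: "card (set ys) = t"
    using distinct_card dist ys xs(2) by metis+
  show "order G = 2 * t"
    using card_Un_disjoint[of "set xs" "set ys"] disj cx cy by (simp add: order_def V VM)
  have ydeg: "degree G y = 2" if y: "y \<in> set ys" for y
  proof -
    obtain i where i: "i < t" "y = ys ! i" using y ys(1) by (auto simp: in_set_conv_nth)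
    have "Suc i mod t \<noteq> i" using i(1) t by (auto simp: mod_Suc)
    moreover have "Suc i mod t < t" using t by simp
    ultimately have "xs ! i \<noteq> xs ! (Suc i mod t)"
      using i(1) dist xs(2) by (simp add: nth_eq_iff_index_eq)
    then show ?thesis using N i by (simp add: degree_def)
  qed
  have xdeg: "degree G x \<noteq> 2" if x: "x \<in> set xs" for x
  proof -
    obtain i where i: "i < t" "x = xs ! i" using x xs(2) by (auto simp: in_set_conv_nth)
    \<comment> \<open>\<open>j\<close> is the cyclic predecessor of \<open>i\<close>; it differs from the successor because \<open>t \<ge> 3\<close>.\<close>
    define j where "j = (if i = 0 then t - 1 else i - 1)"
    have j: "j < t" "Suc j mod t = i" using i(1) t by (auto simp: j_def)
    have "j \<noteq> Suc i mod t" using i(1) t by (auto simp: j_def mod_Suc)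
    moreover have k: "Suc i mod t < t" using t by simp
    ultimately have ne: "xs ! j \<noteq> xs ! (Suc i mod t)"
      using j dist xs(2) by (simp add: nth_eq_iff_index_eq)
    have step: "xs ! (Suc l mod t) \<in> nbhd G (xs ! l)" if "l < t" for l
      using cyc that subgraph_nbhd[OF pG pM M(1)] by (auto simp: cycle_def xs(2))
    have "xs ! (Suc i mod t) \<in> nbhd G x" using step[OF i(1)] by (simp add: i(2))
    moreover have "x \<in> nbhd G (xs ! j)" using step[OF j(1)] by (simp add: i(2) j(2))
    then have "xs ! j \<in> nbhd G x" by (subst nbhd_sym)
    moreover have "x \<in> nbhd G (ys ! i)" using N i by simp
    then have "ys ! i \<in> nbhd G x" by (subst nbhd_sym)
    ultimately have sub: "{ys ! i, xs ! j, xs ! (Suc i mod t)} \<subseteq> nbhd G x" by simp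
    have "ys ! i \<in> set ys" "xs ! j \<in> set xs" "xs ! (Suc i mod t) \<in> set xs"
      using i(1) j(1) k ys(1) xs(2) by simp_all
    then have "ys ! i \<noteq> xs ! j" "ys ! i \<noteq> xs ! (Suc i mod t)"
      using disj by (metis disjoint_iff)+
    then have three: "card {ys ! i, xs ! j, xs ! (Suc i mod t)} = 3" using ne by simp
    have "finite (nbhd G x)"
      using finite_subset[OF nbhd_subset_verts] pG by (simp add: plane_graph_def)
    from card_mono[OF this sub] show ?thesis by (simp add: degree_def three)
  qed
  have "{v \<in> verts G. degree G v = 2} = set ys"
    using V VM ydeg xdeg disj by auto
  then show "card {v \<in> verts G. degree G v = 2} = t" using cy by simp
  obtain S where S: "dominating G S" "card S = domination_number G"
    by (rule domination_number_attained[OF pG])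
  have "t \<le> 2 * card S"
  proof (rule cyclic_pairs_cover[of S t xs ys])
    show "finite S"
      using S(1) pG finite_subset by (auto simp: dominating_def plane_graph_def)
    show "S \<inter> {ys ! i, xs ! i, xs ! (Suc i mod t)} \<noteq> {}" if "i < t" for i
    proof (cases "ys ! i \<in> S")
      case False
      have "ys ! i \<in> verts G" using that ys(1) V by auto
      then have "nbhd G (ys ! i) \<inter> S \<noteq> {}" using False S(1) by (auto simp: dominating_def)
      then show ?thesis using N that by auto
    qed auto
  qed (use t xs(2) dist ys(1,2) disj in auto)
  then show "t \<le> 2 * domination_number G" using S(2) by simp
qed

section \<open>The bound and its sharpness\<close>

theorem theorem7:
  fixes G :: pgraph and n n2 :: nat
  assumes "mop G"
    and "order G = n"
    and "n \<ge> 4"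
    and "card {v \<in> verts G. degree G v = 2} = n2"
  shows "real (domination_number G) \<le> (real n - real n2 + real (ind n n2)) / 2 \<and>
    (extreme G \<or> n = 4 \<longrightarrow>
      real (domination_number G) = (real n - real n2 + real (ind n n2)) / 2)"
proof -
  have upper: "n2 + 2 * domination_number G \<le> n + ind n n2"
    using domination_number_upper[OF assms(1)] assms(2-4) by simp
  have "n2 + 2 * domination_number G = n + ind n n2" if "extreme G \<or> n = 4"
    using that
  proof
    assume "extreme G"
    then obtain t where t: "t_extreme t G" by (auto simp: extreme_def)
    have n: "n = 2 * t"
      using t_extreme_parameters(1)[OF t] unfolding assms(2) .
    have n2: "n2 = t"
      using t_extreme_parameters(2)[OF t] unfolding assms(4) .
    have lower: "t \<le> 2 * domination_number G"
      by (rule t_extreme_parameters(3)[OF t])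
    show ?thesis
    proof (cases "odd t")
      case True
      then have "ind n n2 = 1" unfolding n n2 ind_def by simp
      moreover have "t \<noteq> 2 * domination_number G" using True by auto
      ultimately show ?thesis using upper lower unfolding n n2 by linarith
    next
      case False
      then have "ind n n2 = 0" unfolding n n2 ind_def by simp
      then show ?thesis using upper lower unfolding n n2 by linarith
    qed
  next
    assume n: "n = 4"
    \<comment> \<open>The upper bound reads \<open>n2 + 2 * domination_number G \<le> 4\<close>, and both terms on the left are at
      least 2.\<close>
    have "verts G \<noteq> {}" using assms(2,3) by (auto simp: order_def)
    then have "1 \<le> domination_number G"
      using domination_number_pos[OF mop_plane[OF assms(1)]] by blast
    moreover have "2 \<le> n2" using order_four_degree_two assms n by blast
    moreover have "ind n n2 = 0" using n by (auto simp: ind_def)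
    ultimately show ?thesis using upper n by simp
  qed
  then have "real (n2 + 2 * domination_number G) = real (n + ind n n2)"
    if "extreme G \<or> n = 4" using that by simp
  moreover have "real (n2 + 2 * domination_number G) \<le> real (n + ind n n2)"
    using upper by (rule of_nat_mono)
  ultimately show ?thesis by (auto simp: field_simps)
qed

end
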